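(* Let $b_1,b_2,c_1,c_2,h_1,h_2$ be positive real numbers. Then every solution $\{(x_n,y_n)\}_{n\ge0}$ of the system of difference equations $$x_{n+1}=\frac{b_1x_n}{1+x_n+c_1y_n}+h_1,\qquad y_{n+1}=\frac{b_2y_n}{1+y_n+c_2x_n}+h_2,\qquad n=0,1,\ldots,\quad (x_0,y_0)\in[0,\infty)^2,$$ converges to an equilibrium of the system.
   Context: An equilibrium is a point $(x,y)\in[0,\infty)^2$ with $x=\frac{b_1x}{1+x+c_1y}+h_1$ and $y=\frac{b_2y}{1+y+c_2x}+h_2$. *)

theory Defs
  imports "HOL-Analysis.Analysis"
begin

definition is_equilibrium ::
  "real \<Rightarrow> real \<Rightarrow> real \<Rightarrow> real \<Rightarrow> real \<Rightarrow> real \<Rightarrow> real \<times> real \<Rightarrow> bool" where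
  "is_equilibrium b1 b2 c1 c2 h1 h2 = (\<lambda>(x, y).
     x \<ge> 0 \<and> y \<ge> 0 \<and>
     x = b1 * x / (1 + x + c1 * y) + h1 \<and>
     y = b2 * y / (1 + y + c2 * x) + h2)"

end

theory Submission
  imports Defs
begin

text \<open>
  The map \<open>T\<close> of the system preserves the south-east order. Moreover, it reflects the
  north-east order: \<open>(x, y)\<close> is recovered from the growth ratios \<open>u = x / (1 + x + c\<^sub>1 y)\<close>,
  \<open>v = y / (1 + y + c\<^sub>2 x)\<close> by solving the linear system
  \<open>(1 - u) x - c\<^sub>1 u y = u\<close>, \<open>-c\<^sub>2 v x + (1 - v) y = v\<close>, whose matrix is an M-matrix.
  Two successive points of an orbit are always comparable in one of the two orders. If they are
  ever comparable in the south-east order, they stay so. Otherwise all steps are north-east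
  comparable, and a north-east increase at some step forces one at every earlier step.
  Hence orbits are eventually monotone in each component, and they are bounded.
\<close>

text \<open>After cross-multiplication the product \<open>x * x'\<close> cancels, and what remains
  compares factor by factor.\<close>

lemma competition_ratio_mono:
  fixes c x y x' y' :: real
  assumes "c \<ge> 0" "0 \<le> x" "x \<le> x'" "0 \<le> y'" "y' \<le> y"
  shows "x / (1 + x + c * y) \<le> x' / (1 + x' + c * y')"
proof -
  have cy: "c * y' \<le> c * y" "0 \<le> c * y'"
    using assms by (simp_all add: mult_left_mono)
  have "x * (1 + c * y') \<le> x' * (1 + c * y)"
    using assms cy by (intro mult_mono) auto
  then have "x * (1 + x' + c * y') \<le> x' * (1 + x + c * y)"
    by (simp add: algebra_simps)
  then show ?thesis
    using assms cy by (simp add: field_simps add_pos_nonneg)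
qed

text \<open>Clearing denominators again cancels \<open>x * x'\<close>, so the ratio inequality
  becomes linear in the differences \<open>x - x'\<close> and \<open>y - y'\<close>.\<close>

lemma competition_ratio_reflect_linear:
  fixes c x y x' y' :: real
  assumes "c \<ge> 0" "0 \<le> x" "0 \<le> y" "0 \<le> x'" "0 \<le> y'"
    and le: "x / (1 + x + c * y) \<le> x' / (1 + x' + c * y')"
  shows "(x - x') * (1 + c * y') \<le> x' * c * (y - y')"
proof -
  have "0 < 1 + x + c * y" "0 < 1 + x' + c * y'"
    using assms by (simp_all add: add_pos_nonneg)
  with le have "x * (1 + x' + c * y') \<le> x' * (1 + x + c * y)"
    by (simp add: field_simps)
  then show ?thesis
    by (simp add: algebra_simps)
qed

text \<open>Eliminating \<open>y - y'\<close> from the two linear inequalities leaves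
  \<open>x - x'\<close> times the determinant
  \<open>(1 + c * y') * (1 + d * x') - c * d * x' * y'\<close>, which equals
  \<open>1 + c * y' + d * x'\<close> and is positive. Exchanging the two species gives the bound for
  \<open>y\<close>.\<close>

lemma competition_ratio_reflect_fst:
  fixes c d x y x' y' :: real
  assumes "c > 0" "d > 0" "0 \<le> x" "0 \<le> y" "0 \<le> x'" "0 \<le> y'"
    and "x / (1 + x + c * y) \<le> x' / (1 + x' + c * y')"
    and "y / (1 + y + d * x) \<le> y' / (1 + y' + d * x')"
  shows "x \<le> x'"
proof (rule ccontr)
  assume "\<not> x \<le> x'"
  then have pos: "0 < x - x'" by simp
  have A: "(x - x') * (1 + c * y') \<le> x' * c * (y - y')"
    using assms by (intro competition_ratio_reflect_linear) auto
  have B: "(y - y') * (1 + d * x') \<le> y' * d * (x - x')"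
    using assms by (intro competition_ratio_reflect_linear) auto
  have nn: "0 \<le> c * y'" "0 \<le> d * x'" "0 \<le> x' * c" using assms by simp_all
  \<comment> \<open>Scaling by \<open>1 + d * x'\<close> prepares the substitution of
    \<open>B\<close>, so the sign of \<open>y - y'\<close> never matters.\<close>
  have "(x - x') * ((1 + c * y') * (1 + d * x')) \<le> x' * c * ((y - y') * (1 + d * x'))"
    using mult_right_mono[OF A, of "1 + d * x'"] nn by (simp add: mult.assoc)
  also have "\<dots> \<le> x' * c * (y' * d * (x - x'))"
    using mult_left_mono[OF B nn(3)] .
  finally have "(x - x') * (1 + c * y' + d * x') \<le> 0"
    by (simp add: algebra_simps)
  moreover have "0 < (x - x') * (1 + c * y' + d * x')"
    using pos nn by (intro mult_pos_pos) auto
  ultimately show False by simp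
qed

lemma monoseq_offset_Bseq_convergent:
  fixes f :: "nat \<Rightarrow> real"
  assumes "monoseq (\<lambda>n. f (n + k))" "Bseq f"
  shows "convergent f"
  using assms Bseq_monoseq_convergent[of "\<lambda>n. f (n + k)"] convergent_ignore_initial_segment[of f k]
    Bseq_ignore_initial_segment[of f k] by blast

text \<open>If \<open>Q\<close> fails at arbitrarily late indices, then \<open>P\<close> holds there
  and descends to every earlier index.\<close>

lemma always_or_eventually_other:
  fixes P Q :: "nat \<Rightarrow> bool"
  assumes "\<And>n. P n \<or> Q n" and "\<And>n. P (Suc n) \<Longrightarrow> P n"
  shows "(\<forall>n. P n) \<or> (\<exists>k. \<forall>n\<ge>k. Q n)"
proof (rule disjCI)
  assume no: "\<not> (\<exists>k. \<forall>n\<ge>k. Q n)"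
  show "\<forall>n. P n"
  proof
    fix n
    from no assms(1) obtain m where "n \<le> m" "P m" by meson
    then show "P n"
      by (induction rule: inc_induct) (use assms(2) in blast)+
  qed
qed

theorem theorem2:
  fixes b1 b2 c1 c2 h1 h2 :: real and x y :: "nat \<Rightarrow> real"
  assumes "b1 > 0" "b2 > 0" "c1 > 0" "c2 > 0" "h1 > 0" "h2 > 0"
    and "(x 0, y 0) \<in> {0..} \<times> {0..}"
    and "\<And>n. x (Suc n) = b1 * x n / (1 + x n + c1 * y n) + h1"
    and "\<And>n. y (Suc n) = b2 * y n / (1 + y n + c2 * x n) + h2"
  shows "\<exists>p. is_equilibrium b1 b2 c1 c2 h1 h2 p \<and> (\<lambda>n. (x n, y n)) \<longlonglongrightarrow> p"
proof -
  note pos = assms(1-6) and xs = assms(8) and ys = assms(9)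
  have nn: "0 \<le> x n \<and> 0 \<le> y n" for n
    by (induction n) (use assms in \<open>simp_all add: xs ys\<close>)
  then have x0: "0 \<le> x n" and y0: "0 \<le> y n" for n by auto

  have bdd: "Bseq f"
    if f0: "\<And>n. 0 \<le> f n" and g0: "\<And>n. 0 \<le> g n" and "b > 0" "c > 0" "h > 0"
      and fs: "\<And>n. f (Suc n) = b * f n / (1 + f n + c * g n) + h"
    for f g :: "nat \<Rightarrow> real" and b c h :: real
  proof -
    have "f (Suc n) \<le> b + h" for n
    proof -
      have "f n \<le> 1 + f n + c * g n" "0 < 1 + f n + c * g n"
        using f0[of n] g0[of n] that(4) by (simp_all add: add_pos_nonneg)
      then have "f n / (1 + f n + c * g n) \<le> 1"
        by simp
      from mult_left_mono[OF this, of b] show ?thesis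
        using that(3) by (simp add: fs)
    qed
    \<comment> \<open>The bound \<open>b + h\<close> is available only from index 1 on, since
      \<open>f 0\<close> is arbitrary.\<close>
    then have "Bseq (\<lambda>n. f (Suc n))"
      using f0 by (intro BseqI'[where K = "b + h"]) simp
    then show ?thesis by (simp add: Bseq_Suc_iff)
  qed
  have Bx: "Bseq x" and By: "Bseq y"
    using bdd[of x y b1 c1 h1] bdd[of y x b2 c2 h2] x0 y0 pos xs ys by blast+

  have mono_step: "x (Suc m) \<le> x (Suc n) \<and> y (Suc n) \<le> y (Suc m)"
    if "x m \<le> x n" "y n \<le> y m" for m n
  proof -
    have "b1 * (x m / (1 + x m + c1 * y m)) \<le> b1 * (x n / (1 + x n + c1 * y n))"
      using that pos x0 y0 by (intro mult_left_mono competition_ratio_mono) (auto intro: less_imp_le)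
    moreover have "b2 * (y n / (1 + y n + c2 * x n)) \<le> b2 * (y m / (1 + y m + c2 * x m))"
      using that pos x0 y0 by (intro mult_left_mono competition_ratio_mono) (auto intro: less_imp_le)
    ultimately show ?thesis by (simp add: xs ys)
  qed

  have reflect: "x m \<le> x n \<and> y m \<le> y n"
    if "x (Suc m) \<le> x (Suc n)" "y (Suc m) \<le> y (Suc n)" for m n
  proof -
    have X: "x m / (1 + x m + c1 * y m) \<le> x n / (1 + x n + c1 * y n)"
      using that(1) pos(1) by (simp add: xs flip: times_divide_eq_right)
    have Y: "y m / (1 + y m + c2 * x m) \<le> y n / (1 + y n + c2 * x n)"
      using that(2) pos(2) by (simp add: ys flip: times_divide_eq_right)
    show ?thesis
      using competition_ratio_reflect_fst[OF pos(3,4) x0 y0 x0 y0 X Y]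
        competition_ratio_reflect_fst[OF pos(4,3) y0 x0 y0 x0 Y X] by blast
  qed

  have ev: "\<exists>k. monoseq (\<lambda>n. x (n + k)) \<and> monoseq (\<lambda>n. y (n + k))"
  proof (cases "\<exists>k. x k \<le> x (Suc k) \<and> y (Suc k) \<le> y k \<or> x (Suc k) \<le> x k \<and> y k \<le> y (Suc k)")
    case True
    then obtain k where
      "x k \<le> x (Suc k) \<and> y (Suc k) \<le> y k \<or> x (Suc k) \<le> x k \<and> y k \<le> y (Suc k)" by blast
    then show ?thesis
    proof
      assume *: "x k \<le> x (Suc k) \<and> y (Suc k) \<le> y k"
      \<comment> \<open>The orbit is compared with its own shift: \<open>mono_step\<close> carries
        the order of one step over to the next.\<close>
      have "x (n + k) \<le> x (Suc (n + k)) \<and> y (Suc (n + k)) \<le> y (n + k)" for n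
        by (induction n) (use * mono_step in auto)
      then show ?thesis by (intro exI[of _ k]) (simp add: monoseq_Suc)
    next
      assume *: "x (Suc k) \<le> x k \<and> y k \<le> y (Suc k)"
      have "x (Suc (n + k)) \<le> x (n + k) \<and> y (n + k) \<le> y (Suc (n + k))" for n
        by (induction n) (use * mono_step in auto)
      then show ?thesis by (intro exI[of _ k]) (simp add: monoseq_Suc)
    qed
  next
    case False
    \<comment> \<open>Without a south-east comparison in either direction, both coordinates must
      move the same way.\<close>
    then have "x n \<le> x (Suc n) \<and> y n \<le> y (Suc n) \<or> x (Suc n) \<le> x n \<and> y (Suc n) \<le> y n" for n
      by (meson linear)
    then have "(\<forall>n. x n \<le> x (Suc n) \<and> y n \<le> y (Suc n)) \<or>
        (\<exists>k. \<forall>n\<ge>k. x (Suc n) \<le> x n \<and> y (Suc n) \<le> y n)"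
      \<comment> \<open>Descent of \<open>P\<close> is \<open>reflect\<close> applied to the indices
        \<open>n\<close> and \<open>Suc n\<close>.\<close>
      using always_or_eventually_other[of "\<lambda>n. x n \<le> x (Suc n) \<and> y n \<le> y (Suc n)"
          "\<lambda>n. x (Suc n) \<le> x n \<and> y (Suc n) \<le> y n"] reflect by blast
    then show ?thesis
    proof
      assume "\<forall>n. x n \<le> x (Suc n) \<and> y n \<le> y (Suc n)"
      then show ?thesis by (intro exI[of _ 0]) (simp add: monoseq_Suc)
    next
      assume "\<exists>k. \<forall>n\<ge>k. x (Suc n) \<le> x n \<and> y (Suc n) \<le> y n"
      then obtain k where "\<forall>n\<ge>k. x (Suc n) \<le> x n \<and> y (Suc n) \<le> y n" by blast
      then show ?thesis by (intro exI[of _ k]) (simp add: monoseq_Suc)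
    qed
  qed
  then obtain a b where a: "x \<longlonglongrightarrow> a" and b: "y \<longlonglongrightarrow> b"
    using monoseq_offset_Bseq_convergent Bx By unfolding convergent_def by metis
  have a0: "0 \<le> a" and b0: "0 \<le> b"
    using a b x0 y0 by (auto intro: LIMSEQ_le_const)
  \<comment> \<open>Nonzero denominators at the limit allow passing to the limit in the
    recursion.\<close>
  have "1 + a + c1 * b > 0" "1 + b + c2 * a > 0"
    using a0 b0 pos by (simp_all add: add_pos_nonneg)
  then have "(\<lambda>n. x (Suc n)) \<longlonglongrightarrow> b1 * a / (1 + a + c1 * b) + h1"
    "(\<lambda>n. y (Suc n)) \<longlonglongrightarrow> b2 * b / (1 + b + c2 * a) + h2"
    unfolding xs ys by (auto intro!: tendsto_intros a b)
  then have "a = b1 * a / (1 + a + c1 * b) + h1" "b = b2 * b / (1 + b + c2 * a) + h2"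
    using LIMSEQ_Suc[OF a] LIMSEQ_Suc[OF b] LIMSEQ_unique by blast+
  then have "is_equilibrium b1 b2 c1 c2 h1 h2 (a, b)"
    using a0 b0 by (simp add: is_equilibrium_def)
  then show ?thesis
    using tendsto_Pair[OF a b] by blast
qed

end
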